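(* Let $1<q<p$ be real numbers, and let $t(s_1,s_2)$ be the function (defined in the context) on the set of all $(s_1,s_2)$ with $0<s_1^{\frac{q-1}{p-1}}\le s_2<1$. Then $t(s_1,s_2)$ is strictly decreasing in the variable $s_1$ with $s_2$ fixed. That is, for every $s_2\in(0,1)$ and all $s_1,s_1'$ with $0<s_1<s_1'\le s_2^{\frac{p-1}{q-1}}$, one has $t(s_1',s_2)<t(s_1,s_2)$.
   Context: Fix real numbers $1<q<p$. **The functions $H_q$, $\omega_q$, $\alpha$.** Let $H_q:[1,\frac{q}{q-1}]\to[0,1]$ be given by $H_q(z)=q z^{q-1}-(q-1)z^q$. It is a strictly decreasing bijection, and $\omega_q=H_q^{-1}:[0,1]\to[1,\frac{q}{q-1}]$ denotes its inverse. For $s_2\in(0,1)$ put $$\alpha(s_2)=\frac{\omega_q(s_2)^q}{s_2}-1 .$$ **Domain.** The pairs $(s_1,s_2)$ considered are those with $0<s_1^{\frac{q-1}{p-1}}\le s_2<1$. (They arise as $s_1=\frac{x^p}{\kappa^{p-1}z}$ and $s_2=\frac{x^q}{\kappa^{q-1}y}$, where $x=\int_0^\kappa h$, $y=\int_0^\kappa h^q$, $z=\int_0^\kappa h^p$ for a function $h:(0,\kappa]\to\mathbb{R}^+$.) For such pairs $s_1/s_2<1$. **The function $\tau$ and the number $t_{s_1,s_2}(0)$.** For $(s_1,s_2)$ in the domain and $t\ge 1$ set $$\tau(s_1,s_2,t)=\frac{p-q}{p}\cdot\frac{t^p-s_1}{t^{p-q}-\frac{s_1}{s_2}} .$$ For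 fixed $(s_1,s_2)$ this is strictly increasing in $t\ge 1$. Let $t_{s_1,s_2}(0)$ be the unique $t>1$ with $\tau(s_1,s_2,t)=1$, i.e. the unique $t>1$ with $$(p-q)(t^p-s_1)=p\left(t^{p-q}-\frac{s_1}{s_2}\right).$$ Thus $0<\tau(s_1,s_2,t)\le 1$ for $1\le t\le t_{s_1,s_2}(0)$. **The function $t(s_1,s_2)$.** For $t\in[1,t_{s_1,s_2}(0)]$, writing $\tau=\tau(s_1,s_2,t)$, put $$F_{s_1,s_2}(t)=q\left(p\,\omega_q(\tau)^{q-1}-(p-1)\,\omega_q(\tau)^{q}\right)\left(t^{p-q}-\frac{s_1}{s_2}\right)-(p-q)\,s_1\,\alpha(s_2).$$ Then $t(s_1,s_2)$ is defined as the greatest element $t$ of $[1,t_{s_1,s_2}(0)]$ for which $F_{s_1,s_2}(t)\le 0$. Equivalently: - if $F_{s_1,s_2}(t_{s_1,s_2}(0))\le 0$, then $t(s_1,s_2)=t_{s_1,s_2}(0)$; - otherwise, $t=t(s_1,s_2)$ is the solution in $[1,t_{s_1,s_2}(0))$ of $$q\left(p\,\omega_q(\tau)^{q-1}-(p-1)\,\omega_q(\tau)^{q}\right)\left(t^{p-q}-\frac{s_1}{s_2}\right)=(p-q)\,s_1\,\alpha(s_2),\qquad \tau=\tau(s_1,s_2,t).$$ *)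

theory Defs
  imports Complex_Main
begin

definition H :: "real \<Rightarrow> real \<Rightarrow> real" where
  "H q z = q * z powr (q - 1) - (q - 1) * z powr q"

text \<open>
  The inverse of the bijection \<open>H q\<close> from \<open>[1, q / (q - 1)]\<close> onto \<open>[0, 1]\<close>;
  it is meaningful only for arguments in \<open>[0, 1]\<close>.
\<close>

definition omega :: "real \<Rightarrow> real \<Rightarrow> real" where
  "omega q = the_inv_into {1..q / (q - 1)} (H q)"

definition alpha :: "real \<Rightarrow> real \<Rightarrow> real" where
  "alpha q s2 = omega q s2 powr q / s2 - 1"

definition tau :: "real \<Rightarrow> real \<Rightarrow> real \<Rightarrow> real \<Rightarrow> real \<Rightarrow> real" where
  "tau p q s1 s2 t = (p - q) / p * ((t powr p - s1) / (t powr (p - q) - s1 / s2))"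

text \<open>The number written \<open>t\<close> with index \<open>s1, s2\<close>, evaluated at \<open>0\<close>.\<close>

definition t_zero :: "real \<Rightarrow> real \<Rightarrow> real \<Rightarrow> real \<Rightarrow> real" where
  "t_zero p q s1 s2 = (THE t. 1 < t \<and> tau p q s1 s2 t = 1)"

definition F :: "real \<Rightarrow> real \<Rightarrow> real \<Rightarrow> real \<Rightarrow> real \<Rightarrow> real" where
  "F p q s1 s2 t =
     (let w = omega q (tau p q s1 s2 t) in
      q * (p * w powr (q - 1) - (p - 1) * w powr q) * (t powr (p - q) - s1 / s2)
        - (p - q) * s1 * alpha q s2)"

definition t_fun :: "real \<Rightarrow> real \<Rightarrow> real \<Rightarrow> real \<Rightarrow> real" where
  "t_fun p q s1 s2 =
     (GREATEST t. t \<in> {1..t_zero p q s1 s2} \<and> F p q s1 s2 t \<le> 0)"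

end

theory Submission
  imports Defs "HOL-Analysis.Convex"
begin

text \<open>
  For fixed \<open>t\<close>, the number \<open>\<tau>(s\<^sub>1, s\<^sub>2, t)\<close> increases strictly with \<open>s\<^sub>1\<close>, so
  \<open>w = \<omega>\<^sub>q(\<tau>)\<close> decreases. The monotonicity of \<open>F\<close> in \<open>s\<^sub>1\<close> is not apparent, because its three
  occurrences of \<open>s\<^sub>1\<close> pull in different directions; but only the sign of \<open>F\<close> matters. The
  idea is to eliminate \<open>s\<^sub>1\<close> in favour of \<open>w\<close>. Put \<open>b = t\<^bsup>-q\<^esup>\<close> and
  \<open>G(w) = p w\<^bsup>q-1\<^esup> - (p-1) w\<^bsup>q\<^esup>\<close>. Since \<open>\<tau>\<close> is a quotient of affine functions of \<open>s\<^sub>1\<close>, the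
  relation defining it turns the sign of \<open>F\<close> into the sign of
  \<open>K(w) = q (1/s\<^sub>2 - b) G(w) - \<alpha>(s\<^sub>2) (p b H\<^sub>q(w) - (p - q))\<close>,
  which sees \<open>s\<^sub>1\<close> through \<open>w\<close> alone (lemma \<open>F_sign\<close>).

  The sign of \<open>K\<close> changes at most once, from plus to minus, as \<open>w = \<omega>\<^sub>q(\<tau>)\<close> grows (lemma
  \<open>K_single_crossing\<close>). When \<open>G(w) \<le> 0\<close>, the sign is negative because \<open>p b \<tau> > p - q\<close>. When
  \<open>G(w) > 0\<close>, the condition \<open>K(w) \<le> 0\<close>, being affine in \<open>b\<close>, says that \<open>b\<close> is at least
  \<open>S(w) = (q G(w) / s\<^sub>2 + \<alpha>(s\<^sub>2) (p - q)) / (q G(w) + \<alpha>(s\<^sub>2) p H\<^sub>q(w))\<close>,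
  and \<open>S\<close> (the definition \<open>crossing_level\<close>) is strictly decreasing there. Up to a negative
  factor, the derivative of \<open>S\<close> is a positive multiple of \<open>w\<^bsup>q\<^esup>\<close> plus an affine function of \<open>w\<close>;
  replacing \<open>w\<^bsup>q\<^esup>\<close> by its tangent at \<open>W = \<omega>\<^sub>q(s\<^sub>2)\<close> leaves exactly \<open>q w > 0\<close>
  (lemma \<open>crossing_level_slope_positive\<close>).

  Now let \<open>s\<^sub>1 < s\<^sub>1'\<close> and \<open>t = t(s\<^sub>1', s\<^sub>2)\<close>. As \<open>\<tau>\<close> increases in both \<open>t\<close> and \<open>s\<^sub>1\<close>, the endpoint
  \<open>t(0)\<close> decreases strictly in \<open>s\<^sub>1\<close>, so \<open>t\<close> lies strictly below the endpoint for \<open>s\<^sub>1\<close>. The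
  single crossing upgrades \<open>F \<le> 0\<close> at \<open>s\<^sub>1'\<close> to \<open>F < 0\<close> at \<open>s\<^sub>1\<close>, and by continuity \<open>F\<close> stays negative
  slightly to the right of \<open>t\<close>. Hence \<open>t(s\<^sub>1, s\<^sub>2) > t\<close>. That the greatest elements exist at all
  rests on \<open>F(1) \<le> 0\<close> (lemma \<open>F_at_1\<close>), a consequence of
  \<open>\<alpha>(s\<^sub>2) > 1/s\<^sub>2 - 1\<close>.
\<close>

section \<open>Tangent inequalities for real powers\<close>

text \<open>Young's inequality for the factors \<open>x\<^bsup>r\<^esup>\<close> and \<open>1\<close> with weights \<open>1/r\<close> and \<open>1 - 1/r\<close>.\<close>

lemma powr_Bernoulli:
  fixes x r :: real
  assumes "0 < x" "1 \<le> r"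
  shows "1 + r * (x - 1) \<le> x powr r"
proof -
  have "(x powr r) powr (1 / r) * 1 powr (1 - 1 / r) \<le> 1 / r * x powr r + (1 - 1 / r) * 1"
    using assms by (intro Youngs_inequality_0) auto
  hence "x \<le> 1 / r * x powr r + (1 - 1 / r)"
    using assms by (simp add: powr_powr)
  hence "r * x \<le> r * (1 / r * x powr r + (1 - 1 / r))"
    using assms by (intro mult_left_mono) auto
  thus ?thesis using assms by (simp add: algebra_simps)
qed

text \<open>The left-hand side is the tangent line of \<open>w\<^bsup>r\<^esup>\<close> at \<open>W\<close>; rescaling by \<open>W\<close> reduces the claim to
  Bernoulli's inequality.\<close>

lemma powr_above_tangent:
  fixes w W r :: real
  assumes "0 < w" "0 < W" "1 \<le> r"
  shows "W powr (r - 1) * (r * w - (r - 1) * W) \<le> w powr r"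
proof -
  have "W powr r * (1 + r * (w / W - 1)) \<le> W powr r * (w / W) powr r"
    using assms by (intro mult_left_mono powr_Bernoulli) auto
  also have "\<dots> = w powr r"
    using assms by (simp add: powr_divide)
  also have "W powr r * (1 + r * (w / W - 1)) = W powr (r - 1) * (r * w - (r - 1) * W)"
    using assms by (simp add: powr_diff field_simps)
  finally show ?thesis .
qed

text \<open>Bernoulli's inequality for the base \<open>y\<^bsup>m\<^esup>\<close> and the exponent \<open>r/m\<close>.\<close>

lemma powr_minus_one_ratio:
  fixes y r m :: real
  assumes "0 < y" "0 < m" "m \<le> r"
  shows "r * (y powr m - 1) \<le> m * (y powr r - 1)"
proof -
  have "1 + r / m * (y powr m - 1) \<le> (y powr m) powr (r / m)"
    using assms by (intro powr_Bernoulli) auto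
  also have "\<dots> = y powr r"
    using assms by (simp add: powr_powr)
  finally have "m * (1 + r / m * (y powr m - 1)) \<le> m * (y powr r)"
    using assms by (intro mult_left_mono) auto
  thus ?thesis using assms by (simp add: algebra_simps)
qed

section \<open>The functions H and omega\<close>

lemma H_factored:
  assumes "0 < z"
  shows "H q z = z powr (q - 1) * (q - (q - 1) * z)"
  using assms by (simp add: H_def powr_diff field_simps)

text \<open>Expressing all powers through \<open>w\<^bsup>r-2\<^esup>\<close> makes identities between derivatives polynomial.\<close>

lemma powr_split_diff:
  fixes w r :: real
  assumes "0 < w"
  shows "w powr (r - 1) = w * w powr (r - 2)" "w powr r = w * w * w powr (r - 2)"
proof -
  show "w powr (r - 1) = w * w powr (r - 2)"
    using assms powr_add[of w 1 "r - 2"] by simp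
  have "w powr r = w powr 2 * w powr (r - 2)"
    using powr_add[of w 2 "r - 2"] by simp
  thus "w powr r = w * w * w powr (r - 2)"
    using assms by (simp add: power2_eq_square)
qed

lemma has_real_derivative_H:
  assumes "0 < w"
  shows "(H q has_real_derivative q * (q - 1) * w powr (q - 2) * (1 - w)) (at w)"
proof -
  have "((\<lambda>z. q * z powr (q - 1) - (q - 1) * z powr q) has_real_derivative
          q * ((q - 1) * w powr (q - 2)) - (q - 1) * (q * w powr (q - 1))) (at w)"
    using assms by (auto intro!: derivative_eq_intros)
  moreover have "q * ((q - 1) * w powr (q - 2)) - (q - 1) * (q * w powr (q - 1))
      = q * (q - 1) * w powr (q - 2) * (1 - w)"
    unfolding powr_split_diff[OF assms, of q] by (simp add: algebra_simps)
  ultimately show ?thesis by (simp add: H_def[abs_def])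
qed

lemma H_endpoints:
  assumes "1 < q"
  shows "H q 1 = 1" "H q (q / (q - 1)) = 0"
  using assms by (simp_all add: H_factored)

lemma H_strict_antimono:
  assumes "1 < q" "1 \<le> a" "a < b"
  shows "H q b < H q a"
proof (rule DERIV_neg_imp_decreasing_open[OF assms(3)])
  fix x assume "a < x" "x < b"
  thus "\<exists>y. (H q has_real_derivative y) (at x) \<and> y < 0"
    using assms has_real_derivative_H[of x q]
    by (intro exI[of _ "q * (q - 1) * x powr (q - 2) * (1 - x)"]) (auto intro!: mult_pos_neg mult_pos_pos)
next
  show "continuous_on {a..b} (H q)"
    unfolding H_def[abs_def] using assms by (intro continuous_intros) auto
qed

lemma H_continuous: "continuous_on {1..c} (H q)"
  unfolding H_def[abs_def] by (intro continuous_intros) auto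

lemma H_inj:
  assumes "1 < q"
  shows "inj_on (H q) {1..c}"
proof (rule inj_onI)
  fix x y assume "x \<in> {1..c}" "y \<in> {1..c}" "H q x = H q y"
  thus "x = y"
    using H_strict_antimono[OF assms, of x y] H_strict_antimono[OF assms, of y x]
    by (cases x y rule: linorder_cases) auto
qed

lemma H_image:
  assumes "1 < q"
  shows "H q ` {1..q / (q - 1)} = {0..1}"
proof
  have "1 \<le> q / (q - 1)" using assms by simp
  show "H q ` {1..q / (q - 1)} \<subseteq> {0..1}"
  proof
    fix y assume "y \<in> H q ` {1..q / (q - 1)}"
    then obtain x where "y = H q x" "1 \<le> x" "x \<le> q / (q - 1)" by auto
    thus "y \<in> {0..1}"
      using H_strict_antimono[OF assms, of 1 x] H_strict_antimono[OF assms, of x "q / (q - 1)"]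
        H_endpoints[OF assms] by (cases "x = 1"; cases "x = q / (q - 1)") auto
  qed
  show "{0..1} \<subseteq> H q ` {1..q / (q - 1)}"
  proof
    fix y :: real assume "y \<in> {0..1}"
    hence "\<exists>x\<ge>1. x \<le> q / (q - 1) \<and> H q x = y"
      using H_endpoints[OF assms] \<open>1 \<le> q / (q - 1)\<close> H_continuous
      by (intro IVT2') auto
    thus "y \<in> H q ` {1..q / (q - 1)}" by auto
  qed
qed

lemma omega_props:
  assumes "1 < q" "0 \<le> y" "y \<le> 1"
  shows "H q (omega q y) = y" "1 \<le> omega q y" "omega q y \<le> q / (q - 1)"
proof -
  have y: "y \<in> H q ` {1..q / (q - 1)}" using assms by (simp add: H_image)
  show "H q (omega q y) = y"
    unfolding omega_def by (rule f_the_inv_into_f[OF H_inj y]) fact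
  have "omega q y \<in> {1..q / (q - 1)}"
    unfolding omega_def by (rule the_inv_into_into[OF H_inj y]) (use assms in auto)
  thus "1 \<le> omega q y" "omega q y \<le> q / (q - 1)" by auto
qed

lemma omega_continuous:
  assumes "1 < q"
  shows "continuous_on {0..1} (omega q)"
  unfolding H_image[OF assms, symmetric] omega_def
  by (intro continuous_on_inv_into H_continuous H_inj assms compact_Icc)

lemma omega_strict_antimono:
  assumes "1 < q" "0 \<le> x" "x < y" "y \<le> 1"
  shows "omega q y < omega q x"
proof (rule ccontr)
  assume "\<not> omega q y < omega q x"
  hence "H q (omega q y) \<le> H q (omega q x)"
    using H_strict_antimono[OF assms(1), of "omega q x" "omega q y"] omega_props[OF assms(1), of x] assms
    by (cases "omega q x = omega q y") auto
  thus False using omega_props(1)[OF assms(1)] assms by auto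
qed

section \<open>The sign of F in the variable w\<close>

definition G :: "real \<Rightarrow> real \<Rightarrow> real \<Rightarrow> real" where
  "G p q w = p * w powr (q - 1) - (p - 1) * w powr q"

lemma G_factored:
  assumes "0 < w"
  shows "G p q w = w powr (q - 1) * (p - (p - 1) * w)"
  using assms by (simp add: G_def powr_diff field_simps)

lemma has_real_derivative_G:
  assumes "0 < w"
  shows "(G p q has_real_derivative w powr (q - 2) * (p * (q - 1) - q * (p - 1) * w)) (at w)"
proof -
  have "((\<lambda>z. p * z powr (q - 1) - (p - 1) * z powr q) has_real_derivative
          p * ((q - 1) * w powr (q - 2)) - (p - 1) * (q * w powr (q - 1))) (at w)"
    using assms by (auto intro!: derivative_eq_intros)
  moreover have "p * ((q - 1) * w powr (q - 2)) - (p - 1) * (q * w powr (q - 1))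
      = w powr (q - 2) * (p * (q - 1) - q * (p - 1) * w)"
    unfolding powr_split_diff[OF assms, of q] by (simp add: algebra_simps)
  ultimately show ?thesis by (simp add: G_def[abs_def])
qed

text \<open>Up to a positive factor, this is \<open>F\<close> at the point \<open>t\<close> with \<open>b = t\<^bsup>-q\<^esup>\<close> and \<open>w = \<omega>\<^sub>q(\<tau>)\<close>.\<close>

definition K :: "real \<Rightarrow> real \<Rightarrow> real \<Rightarrow> real \<Rightarrow> real \<Rightarrow> real" where
  "K p q s2 b w = q * (1 / s2 - b) * G p q w - alpha q s2 * (p * b * H q w - (p - q))"

text \<open>The value of \<open>b\<close> at which the affine function \<open>b \<mapsto> K(b, w)\<close> vanishes.\<close>

definition crossing_level :: "real \<Rightarrow> real \<Rightarrow> real \<Rightarrow> real \<Rightarrow> real" where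
  "crossing_level p q s2 w =
    (q * G p q w / s2 + alpha q s2 * (p - q)) /
    (q * G p q w + alpha q s2 * p * H q w)"

text \<open>With \<open>W = \<omega>\<^sub>q(s\<^sub>2)\<close> as parameter, both \<open>s\<^sub>2\<close> and \<open>\<alpha>(s\<^sub>2)\<close> become explicit; the equation
  \<open>H\<^sub>q(W) = s\<^sub>2\<close> cancels the powers from \<open>\<alpha>\<close>.\<close>

lemma omega_alpha:
  assumes "1 < q" "0 < s2" "s2 < 1"
  defines "W \<equiv> omega q s2" and "s \<equiv> q - (q - 1) * omega q s2"
  shows "1 < W" "0 < s" "s2 = W powr (q - 1) * s" "alpha q s2 = W / s - 1" "0 < alpha q s2"
        "1 / s2 - 1 < alpha q s2"
proof -
  have HW: "H q W = s2" "1 \<le> W" using omega_props[of q s2] assms by auto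
  have "W \<noteq> 1" using HW H_endpoints[of q] assms by auto
  thus W: "1 < W" using HW by simp
  show s2: "s2 = W powr (q - 1) * s" using HW W H_factored[of W q] by (simp add: W_def s_def)
  show s: "0 < s" using s2 assms(2) W by (simp add: zero_less_mult_iff)
  have "W powr q = W powr (q - 1) * W" using W by (simp add: powr_diff)
  thus a: "alpha q s2 = W / s - 1"
    using s2 s W unfolding alpha_def W_def[symmetric]
    by (metis mult_divide_mult_cancel_left powr_eq_0_iff less_irrefl not_one_less_zero)
  have "(q - 1) * 1 < (q - 1) * W" using W assms(1) by (intro mult_strict_left_mono) auto
  hence "s < 1" by (simp add: s_def W_def)
  thus "0 < alpha q s2" using a s W by simp
  have "1 < W powr q" using W assms by simp
  thus "1 / s2 - 1 < alpha q s2" unfolding alpha_def W_def[symmetric] using assms(2)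
    by (simp add: divide_strict_right_mono)
qed

text \<open>The bracket in the derivative of the crossing level. It is convex in \<open>w\<close>, and its tangent line
  at \<open>W = \<omega>\<^sub>q(s\<^sub>2)\<close> turns out to be \<open>q w\<close>.\<close>

lemma crossing_level_slope_positive:
  assumes "1 < q" "q < p" "0 < s2" "s2 < 1" "1 \<le> w"
  shows "0 < p / s2 * w powr q + p * (q - 1) - q * (p - 1) * w + alpha q s2 * p * (q - 1) * (1 - w)"
proof -
  define W where "W = omega q s2"
  define s where "s = q - (q - 1) * W"
  note Ws = omega_alpha[OF assms(1,3,4), folded W_def, folded s_def]
  have "p / s2 * (W powr (q - 1) * (q * w - (q - 1) * W)) \<le> p / s2 * w powr q"
    using assms Ws by (intro mult_left_mono powr_above_tangent) auto
  also have "p / s2 * (W powr (q - 1) * (q * w - (q - 1) * W)) = p / s * (q * w - (q - 1) * W)"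
    using Ws(1,2) unfolding Ws(3) by (simp)
  finally have "p / s * (q * w - (q - 1) * W) \<le> p / s2 * w powr q" .
  moreover have "p / s * (q * w - (q - 1) * W) + p * (q - 1) - q * (p - 1) * w
        + (W / s - 1) * p * (q - 1) * (1 - w) = q * w"
  proof -
    have "s * (p / s * (q * w - (q - 1) * W) + p * (q - 1) - q * (p - 1) * w
        + (W / s - 1) * p * (q - 1) * (1 - w)) 
      = p * (q * w - (q - 1) * W) + s * (p * (q - 1) - q * (p - 1) * w)
        + (W - s) * p * (q - 1) * (1 - w)"
      using Ws(2) by (simp add: field_simps)
    also have "\<dots> = s * (q * w)" unfolding s_def by (simp add: algebra_simps)
    finally show ?thesis using Ws(2) by simp
  qed
  moreover have "0 < q * w" using assms by simp
  ultimately show ?thesis unfolding Ws(4) by linarith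
qed

text \<open>The zero \<open>p/(p-1)\<close> of \<open>G\<close> comes before the zero \<open>q/(q-1)\<close> of \<open>H\<close>, as \<open>q < p\<close>.\<close>

lemma GH_pos:
  assumes "1 < q" "q < p" "1 \<le> w" "(p - 1) * w < p"
  shows "0 < G p q w" "0 < H q w"
proof -
  show "0 < G p q w" using assms by (simp add: G_factored)
  have "(q - 1) * ((p - 1) * w) < (q - 1) * p" using assms by (intro mult_strict_left_mono) auto
  hence "0 < (p - 1) * (q - (q - 1) * w)" using assms by (simp add: algebra_simps)
  hence "0 < q - (q - 1) * w" using assms by (simp add: zero_less_mult_iff)
  thus "0 < H q w" using assms by (simp add: H_factored)
qed

lemma crossing_level_strict_antimono:
  assumes q: "1 < q" "q < p" and s2: "0 < s2" "s2 < 1"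
    and w: "1 \<le> w1" "w1 < w2" "(p - 1) * w2 < p"
  shows "crossing_level p q s2 w2 < crossing_level p q s2 w1"
proof (rule DERIV_neg_imp_decreasing[OF w(2)])
  fix w assume "w1 \<le> w" "w \<le> w2"
  hence w1: "1 \<le> w" and "(p - 1) * w \<le> (p - 1) * w2" using w q by auto
  hence "(p - 1) * w < p" using w by simp
  note GH = GH_pos[OF q w1 this]
  define \<alpha> where "\<alpha> = alpha q s2"
  have \<alpha>: "0 < \<alpha>" unfolding \<alpha>_def using omega_alpha q s2 by blast
  define g where "g = w powr (q - 2) * (p * (q - 1) - q * (p - 1) * w)"
  define h where "h = q * (q - 1) * w powr (q - 2) * (1 - w)"
  define N where "N = q * G p q w / s2 + \<alpha> * (p - q)"
  define M where "M = q * G p q w + \<alpha> * p * H q w"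
  have M: "0 < M" unfolding M_def using GH q \<alpha> by (intro add_pos_pos mult_pos_pos) auto
  have dG: "(G p q has_real_derivative g) (at w)" and dH: "(H q has_real_derivative h) (at w)"
    unfolding g_def h_def using w1 has_real_derivative_G has_real_derivative_H by auto
  have "(crossing_level p q s2 has_real_derivative
      ((q * g / s2) * M - N * (q * g + \<alpha> * p * h)) / (M * M)) (at w)"
    unfolding crossing_level_def[abs_def] \<alpha>_def[symmetric] using M s2(1)
    by (auto intro!: derivative_eq_intros dG dH simp: N_def M_def ac_simps)
  moreover have "(q * g / s2) * M - N * (q * g + \<alpha> * p * h)
      = - (\<alpha> * (p - q) * q * w powr (q - 2) *
          (p / s2 * w powr q + p * (q - 1) - q * (p - 1) * w + \<alpha> * p * (q - 1) * (1 - w)))"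
  proof -
    have "0 < w" using w1 by simp
    define Z where "Z = w powr (q - 2)"
    have G: "G p q w = p * (w * Z) - (p - 1) * (w * w * Z)"
      unfolding G_def powr_split_diff[OF \<open>0 < w\<close>, of q] Z_def ..
    have H: "H q w = q * (w * Z) - (q - 1) * (w * w * Z)"
      unfolding H_def powr_split_diff[OF \<open>0 < w\<close>, of q] Z_def ..
    show ?thesis
      unfolding N_def M_def g_def h_def G H powr_split_diff(2)[OF \<open>0 < w\<close>, of q] Z_def[symmetric]
      using s2(1) by (simp add: field_simps)
  qed
  moreover have "0 < \<alpha> * (p - q) * q * w powr (q - 2) *
      (p / s2 * w powr q + p * (q - 1) - q * (p - 1) * w + \<alpha> * p * (q - 1) * (1 - w))"
    using crossing_level_slope_positive[OF q s2 w1] \<alpha> q w1 unfolding \<alpha>_def by (intro mult_pos_pos) auto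
  ultimately show "\<exists>y. (crossing_level p q s2 has_real_derivative y) (at w) \<and> y < 0"
    using M by (auto intro!: exI divide_neg_pos)
qed

lemma K_nonpos_iff:
  assumes "1 < q" "q < p" "0 < s2" "s2 < 1" "1 \<le> w" "(p - 1) * w < p"
  shows "K p q s2 b w \<le> 0 \<longleftrightarrow> crossing_level p q s2 w \<le> b"
    "K p q s2 b w < 0 \<longleftrightarrow> crossing_level p q s2 w < b"
proof -
  have \<alpha>: "0 < alpha q s2" using omega_alpha assms by blast
  have M: "0 < q * G p q w + alpha q s2 * p * H q w"
    using GH_pos[OF assms(1,2,5,6)] assms \<alpha> by (intro add_pos_pos mult_pos_pos) auto
  have "K p q s2 b w = q * G p q w / s2 + alpha q s2 * (p - q)
      - b * (q * G p q w + alpha q s2 * p * H q w)"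
    by (simp add: K_def algebra_simps)
  thus "K p q s2 b w \<le> 0 \<longleftrightarrow> crossing_level p q s2 w \<le> b"
    "K p q s2 b w < 0 \<longleftrightarrow> crossing_level p q s2 w < b"
    using M by (simp_all add: crossing_level_def divide_le_eq divide_less_eq)
qed

text \<open>From the zero of \<open>G\<close> on, the first term of \<open>K\<close> is at most \<open>0\<close>.\<close>

lemma K_neg_if_large:
  assumes "1 < q" "q < p" "0 < s2" "s2 < 1" "1 \<le> w" "p \<le> (p - 1) * w"
    and "b < 1 / s2" "p - q < p * b * H q w"
  shows "K p q s2 b w < 0"
proof -
  have "0 < alpha q s2" using omega_alpha assms by blast
  hence "0 < alpha q s2 * (p * b * H q w - (p - q))" using assms by simp
  moreover have "G p q w \<le> 0" using assms by (simp add: G_factored mult_nonneg_nonpos)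
  hence "q * (1 / s2 - b) * G p q w \<le> 0" using assms by (simp add: mult_nonneg_nonpos)
  ultimately show ?thesis by (simp add: K_def)
qed

text \<open>As long as \<open>G > 0\<close> this is the monotonicity of the crossing level. The lower bound on
  \<open>b H\<^sub>q(w\<^sub>2)\<close> decides the sign beyond the zero of \<open>G\<close>; for \<open>b = t\<^bsup>-q\<^esup>\<close> and \<open>H\<^sub>q(w\<^sub>2) = \<tau>\<close> it is the
  bound \<open>\<tau> > t\<^bsup>q\<^esup> (p - q)/p\<close>.\<close>

lemma K_single_crossing:
  assumes "1 < q" "q < p" "0 < s2" "s2 < 1" "1 \<le> w1" "w1 < w2"
    and "b < 1 / s2" "p - q < p * b * H q w2" and "K p q s2 b w1 \<le> 0"
  shows "K p q s2 b w2 < 0"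
proof (cases "(p - 1) * w2 < p")
  case True
  have "(p - 1) * w1 < (p - 1) * w2" using assms by simp
  hence "(p - 1) * w1 < p" using True by simp
  hence "crossing_level p q s2 w1 \<le> b" using assms True by (subst K_nonpos_iff(1)[symmetric]) auto
  hence "crossing_level p q s2 w2 < b"
    using crossing_level_strict_antimono[OF assms(1-6) True] by simp
  thus ?thesis using assms True by (subst K_nonpos_iff(2)) auto
next
  case False
  thus ?thesis using assms by (intro K_neg_if_large) auto
qed

text \<open>The case \<open>b = 1\<close> is the left end \<open>t = 1\<close>. While \<open>G(w) > 0\<close>, replacing \<open>1/s\<^sub>2 - 1\<close> by the larger \<open>\<alpha>(s\<^sub>2)\<close> in \<open>K\<close>
  reduces the claim to \<open>q G(w) \<le> p H\<^sub>q(w) - (p - q)\<close>, whose two sides differ by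
  \<open>(p - q) (w\<^bsup>q\<^esup> - 1)\<close>.\<close>

lemma K_at_1_nonpos:
  assumes "1 < q" "q < p" "0 < s2" "s2 < 1" "1 \<le> w" "p - q < p * H q w"
  shows "K p q s2 1 w \<le> 0"
proof (cases "(p - 1) * w < p")
  case True
  define A where "A = w powr (q - 1)"
  have A: "1 \<le> A" unfolding A_def using assms by (simp add: ge_one_powr_ge_zero)
  have \<alpha>: "1 / s2 - 1 \<le> alpha q s2" "0 < alpha q s2" using omega_alpha[OF assms(1,3,4)] by auto
  have "q * (1 / s2 - 1) * G p q w \<le> q * alpha q s2 * G p q w"
    using \<alpha> GH_pos[OF assms(1,2,5) True] assms by (intro mult_right_mono mult_left_mono) auto
  also have "\<dots> = alpha q s2 * (q * G p q w)" by simp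
  also have "q * G p q w \<le> p * H q w - (p - q)"
  proof -
    have "p * H q w - q * G p q w = A * ((p - q) * w)"
      using assms by (simp add: H_factored G_factored A_def algebra_simps)
    also have "\<dots> \<ge> 1 * ((p - q) * 1)"
      using A assms by (intro mult_mono) auto
    finally show ?thesis by simp
  qed
  hence "alpha q s2 * (q * G p q w) \<le> alpha q s2 * (p * H q w - (p - q))"
    using \<alpha> by (intro mult_left_mono) auto
  finally show ?thesis by (simp add: K_def)
next
  case False
  thus ?thesis using assms K_neg_if_large[of q p s2 w 1] by auto
qed

section \<open>The functions tau, F and t\<close>

locale admissible =
  fixes p q s1 s2 :: real
  assumes q: "1 < q" and qp: "q < p" and s2: "0 < s2" "s2 < 1" and s1: "0 < s1"
    and s1_bound: "s1 \<le> s2 powr ((p - 1) / (q - 1))"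
begin

lemma s1_less_s2: "s1 < s2"
proof -
  have "s2 powr ((p - 1) / (q - 1)) < s2 powr 1"
    using q qp s2 by (intro powr_less_mono') auto
  thus ?thesis using s1_bound s2 by simp
qed

text \<open>This says \<open>\<tau>(1) < 1\<close>, and the same quantity controls the sign of the derivative of \<open>\<tau>\<close> at
  \<open>t = 1\<close>. It decreases in \<open>s\<^sub>1\<close>; at the extreme value of \<open>s\<^sub>1\<close>, with
  \<open>y = s\<^sub>2\<^bsup>-1/(q-1)\<^esup>\<close>, it is a comparison of \<open>y\<^bsup>q-1\<^esup> - 1\<close> with \<open>y\<^bsup>p-1\<^esup> - 1\<close>.\<close>

lemma tau_1_gap: "0 < q - p * (s1 / s2) + (p - q) * s1"
proof -
  define y where "y = s2 powr (- 1 / (q - 1))"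
  have y: "1 < y" using s2 q powr_less_mono'[of s2 "- 1 / (q - 1)" 0] by (simp add: y_def)
  have ys: "y powr (q - 1) = 1 / s2"
    unfolding y_def powr_powr using q s2 by (simp add: powr_minus_divide)
  have yp: "y powr (p - 1) = 1 / s2 powr ((p - 1) / (q - 1))"
    unfolding y_def powr_powr by (simp flip: powr_minus_divide)
  have y1: "y powr (p - 1) \<le> 1 / s1"
    unfolding yp using s1 s1_bound s2 by (intro divide_left_mono) auto
  have Y1: "1 < y powr (p - 1)" using y q qp by simp
  have "(p - 1) * (p * (y powr (q - 1) - 1)) \<le> p * ((q - 1) * (y powr (p - 1) - 1))"
    using powr_minus_one_ratio[of y "q - 1" "p - 1"] y q qp
    by (subst mult.left_commute) (auto intro!: mult_left_mono)
  also have "\<dots> = (p * (q - 1)) * (y powr (p - 1) - 1)" by simp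
  also have "\<dots> < ((p - 1) * q) * (y powr (p - 1) - 1)"
    using Y1 qp by (intro mult_strict_right_mono) (auto simp: algebra_simps)
  finally have "(p - 1) * (p * (y powr (q - 1) - 1)) < (p - 1) * (q * (y powr (p - 1) - 1))"
    by (simp only: mult.assoc)
  hence "p * (y powr (q - 1) - 1) < q * (y powr (p - 1) - 1)"
    using q qp by simp
  also have "\<dots> \<le> q * (1 / s1 - 1)"
    using y1 q by (intro mult_left_mono) auto
  finally have "s1 * (p * (1 / s2 - 1)) < s1 * (q * (1 / s1 - 1))"
    unfolding ys using s1 by (intro mult_strict_left_mono)
  thus ?thesis using s1 by (simp add: algebra_simps)
qed

lemma denominator_pos:
  assumes "1 \<le> t"
  shows "0 < t powr (p - q) - s1 / s2"
proof -
  have "s1 / s2 < 1" using s1_less_s2 s2 by simp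
  also have "1 \<le> t powr (p - q)" using assms qp by (simp add: ge_one_powr_ge_zero)
  finally show ?thesis by simp
qed

lemma tau_strict_mono:
  assumes "1 \<le> a" "a < b"
  shows "tau p q s1 s2 a < tau p q s1 s2 b"
proof -
  have "(\<lambda>t. (t powr p - s1) / (t powr (p - q) - s1 / s2)) a
      < (\<lambda>t. (t powr p - s1) / (t powr (p - q) - s1 / s2)) b"
  proof (rule DERIV_pos_imp_increasing[OF assms(2)])
    fix t assume "a \<le> t"
    hence t: "1 \<le> t" using assms by simp
    define D where "D = t powr (p - q) - s1 / s2"
    have D: "0 < D" using denominator_pos[OF t] by (simp add: D_def)
    let ?d = "p * t powr (p - 1) * D - (t powr p - s1) * ((p - q) * t powr (p - q - 1))"
    have "((\<lambda>t. (t powr p - s1) / (t powr (p - q) - s1 / s2)) has_real_derivative ?d / (D * D)) (at t)"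
      using D t by (auto intro!: derivative_eq_intros simp: D_def)
    moreover have "0 < ?d"
    proof -
      \<comment> \<open>Up to the factor \<open>P\<close> below, the numerator is \<open>E(t) = q t\<^bsup>p\<^esup> - p (s\<^sub>1/s\<^sub>2) t\<^bsup>q\<^esup> + (p - q) s\<^sub>1\<close>. It is
        positive at \<open>t = 1\<close>, and Bernoulli's inequality with \<open>s\<^sub>1/s\<^sub>2 < 1\<close> gives \<open>E(t) \<ge> E(1)\<close>.\<close>
      have "p * (t powr q - 1) \<le> q * (t powr p - 1)"
        using powr_minus_one_ratio[of t q p] t q qp by simp
      moreover have "p * (t powr q - 1) * (s1 / s2) \<le> p * (t powr q - 1) * 1"
        using s1_less_s2 s2 t q qp by (intro mult_left_mono) (auto simp: ge_one_powr_ge_zero)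
      ultimately have E: "0 < q * t powr p - p * (s1 / s2) * t powr q + (p - q) * s1"
        using tau_1_gap by (simp add: algebra_simps)
      define P where "P = t powr (p - q - 1)"
      define Q where "Q = t powr q"
      have eqs: "t powr (p - q) = t * P" "t powr (p - 1) = P * Q" "t powr p = t * P * Q"
        using t by (simp_all add: P_def Q_def powr_diff)
      have "?d = P * (q * t powr p - p * (s1 / s2) * t powr q + (p - q) * s1)"
        unfolding D_def eqs P_def[symmetric] Q_def[symmetric] by (simp add: algebra_simps)
      thus ?thesis using E t by (simp add: P_def)
    qed
    ultimately show "\<exists>y. ((\<lambda>t. (t powr p - s1) / (t powr (p - q) - s1 / s2)) has_real_derivative y) (at t) \<and> 0 < y"
      using D by (intro exI[of _ "?d / (D * D)"]) auto
  qed
  thus ?thesis unfolding tau_def using q qp by (intro mult_strict_left_mono) auto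
qed

lemma tau_times_denominator:
  assumes "1 \<le> t"
  shows "p * tau p q s1 s2 t * (t powr (p - q) - s1 / s2) = (p - q) * (t powr p - s1)"
  using denominator_pos[OF assms] q qp by (simp add: tau_def)

lemma inverse_power_less:
  assumes "1 \<le> t"
  shows "0 < t powr (- q)" "t powr (- q) < 1 / s2"
proof -
  show "0 < t powr (- q)" using assms by simp
  have "t powr (- q) \<le> t powr 0" using assms q by (intro powr_mono) auto
  also have "\<dots> < 1 / s2" using s2 assms by simp
  finally show "t powr (- q) < 1 / s2" .
qed

text \<open>The identity that eliminates \<open>s\<^sub>1\<close>: it trades the factor \<open>(p - q) s\<^sub>1\<close> in \<open>F\<close> for an expression
  in \<open>\<tau>\<close> and \<open>t\<close>.\<close>

lemma tau_excess:
  assumes "1 \<le> t"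
  shows "(p * t powr (- q) * tau p q s1 s2 t - (p - q)) * (t powr (p - q) - s1 / s2)
      = (p - q) * s1 * (1 / s2 - t powr (- q))"
proof -
  have "t powr (- q) * t powr p = t powr (p - q)"
    using assms by (simp flip: powr_add)
  moreover have "(p * b * T - (p - q)) * D = b * (p * T * D) - (p - q) * D" for b T D
    by (simp add: algebra_simps)
  hence "(p * t powr (- q) * tau p q s1 s2 t - (p - q)) * (t powr (p - q) - s1 / s2)
     = t powr (- q) * (p * tau p q s1 s2 t * (t powr (p - q) - s1 / s2))
        - (p - q) * (t powr (p - q) - s1 / s2)"
    by this
  ultimately show ?thesis
    unfolding tau_times_denominator[OF assms] using s2 by (simp add: field_simps)
qed

lemma tau_gt:
  assumes "1 \<le> t"
  shows "p - q < p * t powr (- q) * tau p q s1 s2 t"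
proof -
  have "0 < (p - q) * s1 * (1 / s2 - t powr (- q))"
    using inverse_power_less[OF assms] s1 qp by simp
  hence "0 < (p * t powr (- q) * tau p q s1 s2 t - (p - q)) * (t powr (p - q) - s1 / s2)"
    by (simp only: tau_excess[OF assms])
  thus ?thesis using denominator_pos[OF assms] by (simp add: zero_less_mult_iff)
qed

lemma tau_pos:
  assumes "1 \<le> t"
  shows "0 < tau p q s1 s2 t"
proof -
  have "s1 < 1" using s1_less_s2 s2 by simp
  also have "1 \<le> t powr p" using assms q qp by (simp add: ge_one_powr_ge_zero)
  finally show ?thesis using denominator_pos[OF assms] q qp by (simp add: tau_def)
qed

lemma tau_at_1: "tau p q s1 s2 1 < 1"
proof -
  have "s1 / s2 < 1" using s1_less_s2 s2 by simp
  moreover have "(p - q) * (1 - s1) < p * (1 - s1 / s2)"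
    using tau_1_gap by (simp add: algebra_simps)
  ultimately show ?thesis using q qp by (simp add: tau_def divide_less_eq)
qed

lemma tau_continuous: "continuous_on {1..c} (tau p q s1 s2)"
  unfolding tau_def[abs_def] using denominator_pos by (intro continuous_intros) force+

lemma t_zero_props: "1 < t_zero p q s1 s2" "tau p q s1 s2 (t_zero p q s1 s2) = 1"
proof -
  \<comment> \<open>\<open>T\<^bsup>q\<^esup> = p/(p-q)\<close> is where the lower bound \<open>\<tau>(t) > (p-q)/p t\<^bsup>q\<^esup>\<close> reaches \<open>1\<close>.\<close>
  define T where "T = (p / (p - q)) powr (1 / q)"
  have T: "1 \<le> T" unfolding T_def using q qp by (intro ge_one_powr_ge_zero) auto
  have "T powr (- q) = (p - q) / p"
    using q qp by (simp add: T_def powr_powr powr_minus)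
  hence "1 \<le> tau p q s1 s2 T"
    using tau_gt[OF T] q qp by simp
  then obtain t where t: "1 \<le> t" "tau p q s1 s2 t = 1"
    using IVT'[of "tau p q s1 s2" 1 1 T] tau_at_1 T tau_continuous by auto
  have "t \<noteq> 1" using t tau_at_1 by auto
  have "\<exists>!t. 1 < t \<and> tau p q s1 s2 t = 1"
  proof (rule ex1I[of _ t])
    fix u assume "1 < u \<and> tau p q s1 s2 u = 1"
    thus "u = t" using t tau_strict_mono[of u t] tau_strict_mono[of t u]
      by (cases u t rule: linorder_cases) auto
  qed (use t \<open>t \<noteq> 1\<close> in auto)
  from theI'[OF this] show "1 < t_zero p q s1 s2" "tau p q s1 s2 (t_zero p q s1 s2) = 1"
    by (auto simp: t_zero_def)
qed

lemma tau_le_1: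
  assumes "1 \<le> t" "t \<le> t_zero p q s1 s2"
  shows "tau p q s1 s2 t \<le> 1"
  using tau_strict_mono[OF assms(1), of "t_zero p q s1 s2"] t_zero_props assms(2)
  by (cases "t = t_zero p q s1 s2") auto

text \<open>Here \<open>\<tau>\<close> stands in place of \<open>H\<^sub>q(\<omega>\<^sub>q(\<tau>))\<close>, which equals \<open>\<tau>\<close> only when \<open>\<tau>\<close> lies in
  \<open>[0, 1]\<close>.\<close>

lemma F_eq_K:
  assumes "1 \<le> t"
  shows "F p q s1 s2 t * (1 / s2 - t powr (- q)) =
    (t powr (p - q) - s1 / s2) *
      (q * (1 / s2 - t powr (- q)) * G p q (omega q (tau p q s1 s2 t))
         - alpha q s2 * (p * t powr (- q) * tau p q s1 s2 t - (p - q)))"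
proof -
  let ?b = "t powr (- q)" and ?D = "t powr (p - q) - s1 / s2"
  let ?g = "G p q (omega q (tau p q s1 s2 t))" and ?E = "p * t powr (- q) * tau p q s1 s2 t - (p - q)"
  have "F p q s1 s2 t * (1 / s2 - ?b) = q * ?g * ?D * (1 / s2 - ?b)
      - alpha q s2 * ((p - q) * s1 * (1 / s2 - ?b))"
    by (simp add: F_def Let_def G_def algebra_simps)
  also have "\<dots> = q * ?g * ?D * (1 / s2 - ?b) - alpha q s2 * (?E * ?D)"
    by (simp only: tau_excess[OF assms])
  also have "\<dots> = ?D * (q * (1 / s2 - ?b) * ?g - alpha q s2 * ?E)"
    by (simp only: algebra_simps)
  finally show ?thesis .
qed

lemma F_sign:
  assumes "1 \<le> t" "t \<le> t_zero p q s1 s2"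
  defines "k \<equiv> K p q s2 (t powr (- q)) (omega q (tau p q s1 s2 t))"
  shows "F p q s1 s2 t \<le> 0 \<longleftrightarrow> k \<le> 0" "F p q s1 s2 t < 0 \<longleftrightarrow> k < 0"
proof -
  have "H q (omega q (tau p q s1 s2 t)) = tau p q s1 s2 t"
    using omega_props(1)[OF q] tau_pos tau_le_1 assms by (simp add: less_imp_le)
  hence eq: "F p q s1 s2 t * (1 / s2 - t powr (- q)) = (t powr (p - q) - s1 / s2) * k"
    unfolding F_eq_K[OF assms(1)] k_def K_def by simp
  have b: "0 < 1 / s2 - t powr (- q)" using inverse_power_less[OF assms(1)] by simp
  have "F p q s1 s2 t \<le> 0 \<longleftrightarrow> F p q s1 s2 t * (1 / s2 - t powr (- q)) \<le> 0"
    using b by (simp add: mult_le_0_iff)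
  also have "\<dots> \<longleftrightarrow> k \<le> 0" unfolding eq using denominator_pos[OF assms(1)] by (auto simp: mult_le_0_iff)
  finally show "F p q s1 s2 t \<le> 0 \<longleftrightarrow> k \<le> 0" .
  have "F p q s1 s2 t < 0 \<longleftrightarrow> F p q s1 s2 t * (1 / s2 - t powr (- q)) < 0"
    using b by (simp add: mult_less_0_iff)
  also have "\<dots> \<longleftrightarrow> k < 0" unfolding eq using denominator_pos[OF assms(1)] by (auto simp: mult_less_0_iff)
  finally show "F p q s1 s2 t < 0 \<longleftrightarrow> k < 0" .
qed

lemma F_at_1: "F p q s1 s2 1 \<le> 0"
proof -
  have "H q (omega q (tau p q s1 s2 1)) = tau p q s1 s2 1" "1 \<le> omega q (tau p q s1 s2 1)"
    using omega_props[OF q] tau_pos[of 1] tau_at_1 by (auto simp: less_imp_le)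
  thus ?thesis using tau_gt[of 1] t_zero_props q qp s2
    by (subst F_sign(1)) (auto intro!: K_at_1_nonpos)
qed

lemma F_continuous: "continuous_on {1..t_zero p q s1 s2} (F p q s1 s2)"
proof -
  have w: "continuous_on {1..t_zero p q s1 s2} (\<lambda>t. omega q (tau p q s1 s2 t))"
    by (rule continuous_on_compose2[OF omega_continuous[OF q] tau_continuous])
       (auto simp: tau_pos tau_le_1 less_imp_le)
  have "omega q (tau p q s1 s2 t) \<noteq> 0" if "t \<in> {1..t_zero p q s1 s2}" for t
    using omega_props(2)[OF q, of "tau p q s1 s2 t"] tau_pos[of t] tau_le_1[of t] that by auto
  thus ?thesis
    unfolding F_def[abs_def] Let_def by (intro continuous_intros w) auto
qed

text \<open>The maximum exists because the set is compact, by continuity of \<open>F\<close>, and contains \<open>1\<close>.\<close>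

lemma t_fun_greatest:
  shows "t_fun p q s1 s2 \<in> {1..t_zero p q s1 s2}" "F p q s1 s2 (t_fun p q s1 s2) \<le> 0"
    and "\<And>t. t \<in> {1..t_zero p q s1 s2} \<Longrightarrow> F p q s1 s2 t \<le> 0 \<Longrightarrow> t \<le> t_fun p q s1 s2"
proof -
  define A where "A = {t \<in> {1..t_zero p q s1 s2}. F p q s1 s2 t \<le> 0}"
  have "closed (F p q s1 s2 -` {..0} \<inter> {1..t_zero p q s1 s2})"
    using F_continuous continuous_on_closed_vimage closed_atLeastAtMost closed_atMost by blast
  moreover have "F p q s1 s2 -` {..0} \<inter> {1..t_zero p q s1 s2} = A"
    by (auto simp: A_def)
  ultimately have "closed A" by simp
  moreover have "A \<subseteq> {1..t_zero p q s1 s2}" by (auto simp: A_def)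
  ultimately have "compact A" by (metis compact_Icc compact_Int_closed inf.absorb_iff2)
  moreover have "1 \<in> A" using F_at_1 t_zero_props by (simp add: A_def)
  ultimately obtain m where m: "m \<in> A" "\<And>t. t \<in> A \<Longrightarrow> t \<le> m"
    using compact_attains_sup[of A] by auto
  have "t_fun p q s1 s2 = m"
    unfolding t_fun_def using m by (intro Greatest_equality) (auto simp: A_def)
  thus "t_fun p q s1 s2 \<in> {1..t_zero p q s1 s2}" "F p q s1 s2 (t_fun p q s1 s2) \<le> 0"
    "\<And>t. t \<in> {1..t_zero p q s1 s2} \<Longrightarrow> F p q s1 s2 t \<le> 0 \<Longrightarrow> t \<le> t_fun p q s1 s2"
    using m by (auto simp: A_def)
qed

text \<open>Strict negativity persists slightly to the right of \<open>t\<close>, and there is room there, as \<open>t\<close> lies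
  below the endpoint.\<close>

lemma less_t_fun:
  assumes "1 \<le> t" "t < t_zero p q s1 s2" "F p q s1 s2 t < 0"
  shows "t < t_fun p q s1 s2"
proof -
  let ?I = "{1..t_zero p q s1 s2}"
  have "(F p q s1 s2 \<longlongrightarrow> F p q s1 s2 t) (at t within ?I)"
    using F_continuous assms by (auto simp: continuous_on_def)
  hence "\<forall>\<^sub>F u in at t within ?I. F p q s1 s2 u < 0"
    using assms(3) by (rule order_tendstoD)
  then obtain d where d: "0 < d" "\<And>u. u \<in> ?I \<Longrightarrow> u \<noteq> t \<Longrightarrow> dist u t < d \<Longrightarrow> F p q s1 s2 u < 0"
    by (auto simp: eventually_at)
  define u where "u = min (t + d / 2) (t_zero p q s1 s2)"
  have "t < u" "u \<in> ?I" "dist u t < d" using d assms by (auto simp: u_def dist_real_def)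
  hence "u \<le> t_fun p q s1 s2" using d(2)[of u] by (intro t_fun_greatest(3)) auto
  thus ?thesis using \<open>t < u\<close> by simp
qed

end

text \<open>After cross-multiplication the difference is \<open>s\<^sub>1' - s\<^sub>1\<close> times \<open>t\<^bsup>p\<^esup> (1/s\<^sub>2 - t\<^bsup>-q\<^esup>)\<close>.\<close>

lemma tau_strict_mono_s1:
  assumes "admissible p q s1 s2" "admissible p q s1' s2" "s1 < s1'" "1 \<le> t"
  shows "tau p q s1 s2 t < tau p q s1' s2 t"
proof -
  interpret a: admissible p q s1 s2 by fact
  interpret b: admissible p q s1' s2 by fact
  have "0 < t powr p * (1 / s2 - t powr (- q))"
    using a.inverse_power_less[OF assms(4)] assms(4) by simp
  also have "\<dots> = t powr p / s2 - t powr (p - q)"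
    using assms(4) by (simp add: right_diff_distrib flip: powr_add)
  finally have "0 < (s1' - s1) * (t powr p / s2 - t powr (p - q))" using assms(3) by simp
  also have "\<dots> = (t powr p - s1') * (t powr (p - q) - s1 / s2)
      - (t powr p - s1) * (t powr (p - q) - s1' / s2)"
    using a.s2 by (simp add: field_simps)
  finally have "(t powr p - s1) * (t powr (p - q) - s1' / s2)
      < (t powr p - s1') * (t powr (p - q) - s1 / s2)"
    by simp
  moreover have frac_less: "A / D < B / E" if "A * E < B * D" "0 < D" "0 < E" for A B D E :: real
    using that by (simp add: field_simps)
  ultimately have "(t powr p - s1) / (t powr (p - q) - s1 / s2)
      < (t powr p - s1') / (t powr (p - q) - s1' / s2)"
    using a.denominator_pos[OF assms(4)] b.denominator_pos[OF assms(4)] frac_less by blast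
  thus ?thesis unfolding tau_def using a.q a.qp by (intro mult_strict_left_mono) auto
qed

theorem theorem2p1:
  fixes p q s1 s1' s2 :: real
  assumes "1 < q" and "q < p"
    and "0 < s2" and "s2 < 1"
    and "0 < s1" and "s1 < s1'" and "s1' \<le> s2 powr ((p - 1) / (q - 1))"
  shows "t_fun p q s1' s2 < t_fun p q s1 s2"
proof -
  interpret a: admissible p q s1 s2 using assms by unfold_locales auto
  interpret b: admissible p q s1' s2 using assms by unfold_locales auto
  note tau_less = tau_strict_mono_s1[OF a.admissible_axioms b.admissible_axioms assms(6)]
  define t where "t = t_fun p q s1' s2"
  have t: "1 \<le> t" "t \<le> t_zero p q s1' s2" and F': "F p q s1' s2 t \<le> 0"
    using b.t_fun_greatest by (auto simp: t_def)
  have "tau p q s1 s2 (t_zero p q s1' s2) < tau p q s1 s2 (t_zero p q s1 s2)"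
    using tau_less[of "t_zero p q s1' s2"] a.t_zero_props b.t_zero_props by simp
  hence "t_zero p q s1' s2 < t_zero p q s1 s2"
    using a.tau_strict_mono[of "t_zero p q s1 s2" "t_zero p q s1' s2"] a.t_zero_props
    by (cases "t_zero p q s1 s2" "t_zero p q s1' s2" rule: linorder_cases) auto
  hence t0: "t < t_zero p q s1 s2" using t by simp
  have taus: "0 < tau p q s1 s2 t" "tau p q s1 s2 t < tau p q s1' s2 t" "tau p q s1' s2 t \<le> 1"
    using a.tau_pos tau_less b.tau_le_1 t by auto
  define w where "w = omega q (tau p q s1 s2 t)"
  define w' where "w' = omega q (tau p q s1' s2 t)"
  have "w' < w" unfolding w_def w'_def using taus assms(1) by (intro omega_strict_antimono) auto
  moreover have "1 \<le> w'" unfolding w'_def using taus assms(1) by (intro omega_props) auto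
  moreover have "H q w = tau p q s1 s2 t" unfolding w_def using taus assms(1) by (intro omega_props) auto
  moreover have "K p q s2 (t powr (- q)) w' \<le> 0" using b.F_sign(1)[OF t] F' by (simp add: w'_def)
  ultimately have "K p q s2 (t powr (- q)) w < 0"
    using a.tau_gt[OF t(1)] a.inverse_power_less[OF t(1)] assms
    by (intro K_single_crossing[of q p s2 w' w]) auto
  hence "F p q s1 s2 t < 0" using a.F_sign(2)[of t] t t0 by (simp add: w_def)
  hence "t < t_fun p q s1 s2" using a.less_t_fun t t0 by simp
  thus ?thesis by (simp add: t_def)
qed

end
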